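(* Let $N\ge 2$, let $n_1\ge 0$ and $n_2,\dots,n_N\ge 1$ be integers, and write $|n|=n_2+\cdots+n_N$ and $|k|=k_2+\cdots+k_N$ for $k=(k_2,\dots,k_N)$. The number of acyclic orientations of the complete $N$-partite graph $K_{n_1,\dots,n_N}$ equals \[ \sum_{(k_2,\dots,k_N)\in[n_2]\times\cdots\times[n_N]} (-1)^{|n|-|k|}\,(1+|k|)^{n_1}\,|k|!\,\prod_{i=2}^N \left\{ {n_i \atop k_i} \right\}, \] where $\left\{ {a \atop b} \right\}$ is the Stirling number of the second kind.
   Context: $K_{n_1,\dots,n_N}$ is the complete multipartite graph whose vertex set is partitioned into parts of sizes $n_1,\dots,n_N$, with two vertices adjacent iff they lie in different parts. An acyclic orientation is an assignment of directions to all edges without directed cycles. $[a]=\{1,\dots,a\}$. *)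

theory Defs
  imports "HOL-Combinatorics.Stirling" "HOL-Library.FuncSet"
begin

text \<open>
  A simple graph is given by its set of edges, each edge being a two-element set of vertices.
  The vertices of the complete multipartite graph with part sizes \<open>n 1, \<dots>, n N\<close> are the
  pairs \<open>(i, j)\<close> with \<open>1 \<le> i \<le> N\<close> and \<open>1 \<le> j \<le> n i\<close>; the part of a vertex is its first
  component, and a part may be empty.
\<close>

definition multipartite_verts :: "nat \<Rightarrow> (nat \<Rightarrow> nat) \<Rightarrow> (nat \<times> nat) set" where
  "multipartite_verts N n = (SIGMA i:{1..N}. {1..n i})"

definition multipartite_edges :: "nat \<Rightarrow> (nat \<Rightarrow> nat) \<Rightarrow> (nat \<times> nat) set set" where
  "multipartite_edges N n =
     {{u, v} | u v. u \<in> multipartite_verts N n \<and> v \<in> multipartite_verts N n \<and> fst u \<noteq> fst v}"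

text \<open>
  An orientation is the set of the directed edges, where \<open>(u, v)\<close> stands for the edge
  \<open>{u, v}\<close> directed from \<open>u\<close> to \<open>v\<close>. The second condition is meant for edge sets without loops.
\<close>

definition orientation :: "'a set set \<Rightarrow> ('a \<times> 'a) set \<Rightarrow> bool" where
  "orientation E D \<longleftrightarrow>
     (\<forall>u v. (u, v) \<in> D \<longrightarrow> {u, v} \<in> E) \<and>
     (\<forall>u v. {u, v} \<in> E \<longrightarrow> ((u, v) \<in> D \<longleftrightarrow> (v, u) \<notin> D))"

definition acyclic_orientations :: "'a set set \<Rightarrow> ('a \<times> 'a) set set" where
  "acyclic_orientations E = {D. orientation E D \<and> acyclic D}"

end

theory Submission
  imports Defs
begin

text \<open>
  Inclusion-exclusion over the sources of an acyclic orientation expresses the number of acyclic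
  orientations of a graph as an alternating sum over the nonempty independent sets \<open>S\<close>, of the
  numbers for the graph with \<open>S\<close> deleted. In a complete multipartite graph each such \<open>S\<close> lies in
  one part, so this is a recursion in the part sizes. Its solution is the sum of
  \<open>|k|! \<Prod>i. (-1)^(n i - k i) S(n i, k i)\<close> over all \<open>k\<close>, where the first part is
  treated like the others; summing over \<open>k 1\<close> then produces the factor \<open>(1 + |k|)^(n 1)\<close>.
\<close>

section \<open>Signed Stirling numbers\<close>

text \<open>Combinatorially, in a partition of \<open>Suc m\<close> elements into
  \<open>Suc k\<close> blocks, \<open>t\<close> counts the elements outside the block of a
  distinguished element. The proof is an induction using Pascal's rule and the Stirling
  recurrence.\<close>

lemma sum_binomial_Stirling: "(\<Sum>t\<le>m. (m choose t) * Stirling t k) = Stirling (Suc m) (Suc k)"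
proof (induction m arbitrary: k)
  case 0
  then show ?case by (cases k) auto
next
  case (Suc m)
  have "(\<Sum>t\<le>Suc m. (Suc m choose t) * Stirling t k)
      = Stirling 0 k + (\<Sum>t\<le>m. ((m choose t) + (m choose Suc t)) * Stirling (Suc t) k)"
    by (subst sum.atMost_Suc_shift) simp
  also have "\<dots> = (\<Sum>t\<le>m. (m choose t) * Stirling (Suc t) k) +
      (Stirling 0 k + (\<Sum>t\<le>m. (m choose Suc t) * Stirling (Suc t) k))"
    by (simp add: sum.distrib algebra_simps)
  \<comment> \<open>The term for \<open>t = 0\<close> completes the shifted sum, and the extra term
    for \<open>t = Suc m\<close> has binomial coefficient 0, so the induction hypothesis
    applies.\<close>
  also have "Stirling 0 k + (\<Sum>t\<le>m. (m choose Suc t) * Stirling (Suc t) k)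
      = (\<Sum>t\<le>Suc m. (m choose t) * Stirling t k)"
    by (subst sum.atMost_Suc_shift) simp
  also have "\<dots> = Stirling (Suc m) (Suc k)"
    using Suc.IH by simp
  also have "(\<Sum>t\<le>m. (m choose t) * Stirling (Suc t) k) = k * Stirling (Suc m) (Suc k) + Stirling (Suc m) k"
  proof (cases k)
    case 0
    then show ?thesis by simp
  next
    case (Suc j)
    have "(\<Sum>t\<le>m. (m choose t) * Stirling (Suc t) (Suc j))
        = Suc j * (\<Sum>t\<le>m. (m choose t) * Stirling t (Suc j)) + (\<Sum>t\<le>m. (m choose t) * Stirling t j)"
      by (simp add: sum.distrib sum_distrib_left algebra_simps)
    then show ?thesis
      using Suc.IH Suc by simp
  qed
  finally show ?case by simp
qed

text \<open>These are the coefficients of the power x^m in the basis of rising factorials. For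
  \<open>k \<le> m\<close> the exponent \<open>m + k\<close> has the parity of \<open>m - k\<close>,
  and it avoids truncated subtraction.\<close>

definition signed_Stirling :: "nat \<Rightarrow> nat \<Rightarrow> int" where
  "signed_Stirling m k = (- 1) ^ (m + k) * int (Stirling m k)"

lemma signed_Stirling_0_0 [simp]: "signed_Stirling 0 0 = 1"
  and signed_Stirling_Suc_0 [simp]: "signed_Stirling (Suc m) 0 = 0"
  by (simp_all add: signed_Stirling_def)

lemma signed_Stirling_eq_0: "m < k \<Longrightarrow> signed_Stirling m k = 0"
  by (simp add: signed_Stirling_def)

lemma signed_Stirling_Suc_Suc:
  "signed_Stirling (Suc m) (Suc k) = signed_Stirling m k - int (Suc k) * signed_Stirling m (Suc k)"
  by (simp add: signed_Stirling_def algebra_simps)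

text \<open>The signs combine to one that does not depend on \<open>t\<close>, which leaves
  \<open>sum_binomial_Stirling\<close> without one term. The sum describes how one part contributes
  when \<open>t\<close> of its \<open>m\<close> vertices are deleted with inclusion-exclusion
  signs.\<close>

lemma sum_binomial_signed_Stirling:
  "(\<Sum>t=1..m. int (m choose t) * (- 1) ^ Suc t * signed_Stirling (m - t) k)
    = int (Suc k) * signed_Stirling m (Suc k)"
proof -
  have "(\<Sum>t\<le>m. (m choose t) * Stirling (m - t) k) = Stirling (Suc m) (Suc k)"
    unfolding sum_binomial_Stirling [symmetric]
    by (rule sum.reindex_bij_witness [of _ "\<lambda>t. m - t" "\<lambda>t. m - t"])
      (auto simp: binomial_symmetric [symmetric])
  moreover have "{..m} = insert 0 {1..m}"
    by auto
  \<comment> \<open>The missing term for \<open>t = 0\<close> is \<open>Stirling m k\<close>, which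
    is exactly the second summand in the recurrence for
    \<open>Stirling (Suc m) (Suc k)\<close>.\<close>
  ultimately have *: "(\<Sum>t=1..m. (m choose t) * Stirling (m - t) k) = Suc k * Stirling m (Suc k)"
    by simp
  have "int (m choose t) * (- 1) ^ Suc t * signed_Stirling (m - t) k
      = (- 1) ^ (m + Suc k) * int ((m choose t) * Stirling (m - t) k)" if "t \<in> {1..m}" for t
  proof -
    have "(- 1 :: int) ^ Suc t * (- 1) ^ (m - t + k) = (- 1) ^ (m + Suc k)"
      using that by (simp flip: power_add)
    then show ?thesis
      by (simp add: signed_Stirling_def ac_simps)
  qed
  then have "(\<Sum>t=1..m. int (m choose t) * (- 1) ^ Suc t * signed_Stirling (m - t) k)
      = (- 1) ^ (m + Suc k) * int (\<Sum>t=1..m. (m choose t) * Stirling (m - t) k)"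
    by (simp only: sum_distrib_left of_nat_sum cong: sum.cong)
  also have "\<dots> = int (Suc k) * signed_Stirling m (Suc k)"
    unfolding * by (simp add: signed_Stirling_def algebra_simps)
  finally show ?thesis .
qed

text \<open>The term gained at \<open>x = Suc M\<close> vanishes because \<open>m < Suc M\<close>,
  so the shift costs only the term at 0.\<close>

lemma sum_shift_signed_Stirling:
  assumes "m \<le> M"
  shows "(\<Sum>x\<le>M. g (Suc x) * signed_Stirling m (Suc x)) = (\<Sum>x\<le>M. g x * signed_Stirling m x)
    - g 0 * signed_Stirling m 0"
proof -
  have "(\<Sum>x\<le>Suc M. g x * signed_Stirling m x) = (\<Sum>x\<le>M. g x * signed_Stirling m x)"
    using assms by (simp add: signed_Stirling_eq_0)
  then show ?thesis
    by (subst (asm) sum.atMost_Suc_shift) simp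
qed

text \<open>Divided by \<open>fact K\<close>, this is the expansion of the \<open>m\<close>-th power
  of \<open>1 + K\<close> in rising factorials. It evaluates the sum over the index of the first
  part in closed form.\<close>

lemma sum_fact_signed_Stirling:
  "m \<le> M \<Longrightarrow> (\<Sum>x\<le>M. fact (K + x) * signed_Stirling m x) = fact K * (1 + int K) ^ m"
proof (induction m arbitrary: M)
  case 0
  have "(\<Sum>x\<le>M. fact (K + x) * signed_Stirling 0 x) = (\<Sum>x\<in>{0}. fact (K + x) * signed_Stirling 0 x)"
    by (rule sum.mono_neutral_right) (auto simp: signed_Stirling_eq_0)
  then show ?case by simp
next
  case (Suc m)
  then obtain L where M: "M = Suc L" "m \<le> L"
    by (cases M) auto
  have "(\<Sum>x\<le>M. fact (K + x) * signed_Stirling (Suc m) x)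
      = (\<Sum>x\<le>L. fact (K + Suc x) * signed_Stirling m x)
        - (\<Sum>x\<le>L. (fact (K + Suc x) * int (Suc x)) * signed_Stirling m (Suc x))"
    unfolding M(1) by (subst sum.atMost_Suc_shift)
      (simp add: signed_Stirling_Suc_Suc sum_subtractf algebra_simps)
  also have "(\<Sum>x\<le>L. (fact (K + Suc x) * int (Suc x)) * signed_Stirling m (Suc x))
      = (\<Sum>x\<le>L. (fact (K + x) * int x) * signed_Stirling m x)"
    using sum_shift_signed_Stirling [OF M(2), of "\<lambda>x. fact (K + x) * int x"] by simp
  \<comment> \<open>Termwise,
    \<open>fact (K + Suc x) - x * fact (K + x) = (1 + K) * fact (K + x)\<close>.\<close>
  also have "(\<Sum>x\<le>L. fact (K + Suc x) * signed_Stirling m x) -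
      (\<Sum>x\<le>L. (fact (K + x) * int x) * signed_Stirling m x)
      = (1 + int K) * (\<Sum>x\<le>L. fact (K + x) * signed_Stirling m x)"
    unfolding sum_distrib_left sum_subtractf [symmetric]
    by (rule sum.cong) (simp_all add: algebra_simps)
  also have "\<dots> = fact K * (1 + int K) ^ Suc m"
    using Suc.IH [OF M(2)] by simp
  finally show ?case .
qed


section \<open>The symmetric formula\<close>

text \<open>Every function in \<open>PiE I B\<close> is \<open>k(i := x)\<close> for a unique pair
  of \<open>k\<close> on \<open>I - {i}\<close> and \<open>x\<close> in \<open>B i\<close>; this
  makes coordinate \<open>i\<close> the innermost summation.\<close>

lemma sum_PiE_remove:
  assumes "i \<in> I"
  shows "(\<Sum>k\<in>PiE I B. F k) = (\<Sum>k\<in>PiE (I - {i}) B. \<Sum>x\<in>B i. F (k(i := x)))"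
proof -
  have "inj_on (\<lambda>(x, k). k(i := x)) (B i \<times> PiE (I - {i}) B)"
    by (rule inj_combinator) simp
  moreover have "PiE I B = (\<lambda>(x, k). k(i := x)) ` (B i \<times> PiE (I - {i}) B)"
    using PiE_insert_eq [of i "I - {i}" B] assms by (simp add: insert_absorb)
  ultimately have "(\<Sum>k\<in>PiE I B. F k) = (\<Sum>(x, k)\<in>B i \<times> PiE (I - {i}) B. F (k(i := x)))"
    by (simp only: sum.reindex) (simp add: case_prod_unfold)
  also have "\<dots> = (\<Sum>x\<in>B i. \<Sum>k\<in>PiE (I - {i}) B. F (k(i := x)))"
    by (rule sum.cartesian_product [symmetric])
  also have "\<dots> = (\<Sum>k\<in>PiE (I - {i}) B. \<Sum>x\<in>B i. F (k(i := x)))"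
    by (rule sum.swap)
  finally show ?thesis .
qed

text \<open>
  The bound \<open>M\<close> only makes the sum finite: the terms with some \<open>k i > m i\<close> vanish.
  A range that is independent of \<open>m\<close> keeps the index set fixed in the recursion.
\<close>

definition Stirling_sum :: "nat \<Rightarrow> 'i set \<Rightarrow> ('i \<Rightarrow> nat) \<Rightarrow> int" where
  "Stirling_sum M I m =
    (\<Sum>k\<in>(\<Pi>\<^sub>E i\<in>I. {..M}). fact (sum k I) * (\<Prod>i\<in>I. signed_Stirling (m i) (k i)))"

lemma Stirling_sum_cong: "(\<And>i. i \<in> I \<Longrightarrow> m i = m' i) \<Longrightarrow> Stirling_sum M I m = Stirling_sum M I m'"
  by (simp add: Stirling_sum_def)

text \<open>Only the zero function on \<open>I\<close> contributes. The value 1 matches the empty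
  orientation of the graph without vertices, the base case of the recursion.\<close>

lemma Stirling_sum_zero:
  assumes "finite I"
  shows "Stirling_sum M I (\<lambda>_. 0) = 1"
proof -
  have "Stirling_sum M I (\<lambda>_. 0)
      = (\<Sum>k\<in>{\<lambda>i\<in>I. 0}. fact (sum k I) * (\<Prod>i\<in>I. signed_Stirling 0 (k i)))"
    unfolding Stirling_sum_def
  proof (rule sum.mono_neutral_right)
    show "finite (\<Pi>\<^sub>E i\<in>I. {..M})"
      using assms by (simp add: finite_PiE)
    show "\<forall>k\<in>(\<Pi>\<^sub>E i\<in>I. {..M}) - {\<lambda>i\<in>I. 0}. fact (sum k I) * (\<Prod>i\<in>I. signed_Stirling 0 (k i)) = 0"
    proof
      fix k assume k: "k \<in> (\<Pi>\<^sub>E i\<in>I. {..M}) - {\<lambda>i\<in>I. 0}"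
      then obtain i where "i \<in> I" "k i \<noteq> 0"
        by (fastforce simp: PiE_iff extensional_def fun_eq_iff)
      then have "\<exists>i\<in>I. signed_Stirling 0 (k i) = 0"
        using signed_Stirling_eq_0 [of 0 "k i"] by auto
      then show "fact (sum k I) * (\<Prod>i\<in>I. signed_Stirling 0 (k i)) = 0"
        using assms by simp
    qed
  qed auto
  then show ?thesis by simp
qed

text \<open>This isolates the dependence on \<open>m i\<close>: it serves both to change a single
  part size in the recursion and to sum out the first part at the end.\<close>

lemma Stirling_sum_remove:
  assumes "finite I" "i \<in> I"
  shows "Stirling_sum M I m = (\<Sum>k\<in>(\<Pi>\<^sub>E j\<in>I - {i}. {..M}).
    (\<Prod>j\<in>I - {i}. signed_Stirling (m j) (k j)) *
    (\<Sum>x\<le>M. fact (sum k (I - {i}) + x) * signed_Stirling (m i) x))"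
proof -
  have "fact (sum (k(i := x)) I) * (\<Prod>j\<in>I. signed_Stirling (m j) ((k(i := x)) j))
     = (\<Prod>j\<in>I - {i}. signed_Stirling (m j) (k j)) * (fact (sum k (I - {i}) + x) * signed_Stirling (m i) x)"
    for k x
  proof -
    have "sum (k(i := x)) (I - {i}) = sum k (I - {i})"
      by (rule sum.cong) auto
    moreover have "(\<Prod>j\<in>I - {i}. signed_Stirling (m j) ((k(i := x)) j))
        = (\<Prod>j\<in>I - {i}. signed_Stirling (m j) (k j))"
      by (rule prod.cong) auto
    ultimately show ?thesis
      using assms by (simp only: sum.remove prod.remove) (simp add: ac_simps)
  qed
  then show ?thesis
    unfolding Stirling_sum_def sum_PiE_remove [OF assms(2)] by (simp add: sum_distrib_left)
qed

text \<open>By linearity the sum over \<open>t\<close> acts on the factor of part \<open>i\<close>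
  alone, where \<open>sum_binomial_signed_Stirling\<close> raises the index to \<open>Suc x\<close>
  at the price of a factor \<open>Suc x\<close>. Shifting the index back gives the factor
  \<open>k i\<close> and lowers the factorial by one.\<close>

lemma Stirling_sum_remove_part:
  assumes "finite I" "i \<in> I" "m i \<le> M"
  shows "(\<Sum>t=1..m i. int (m i choose t) * (- 1) ^ Suc t * Stirling_sum M I (m(i := m i - t)))
    = (\<Sum>k\<in>(\<Pi>\<^sub>E i\<in>I. {..M}).
        fact (sum k I - 1) * int (k i) * (\<Prod>i\<in>I. signed_Stirling (m i) (k i)))"
proof -
  let ?P = "\<lambda>k. \<Prod>j\<in>I - {i}. signed_Stirling (m j) (k j)"
  let ?c = "\<lambda>t. int (m i choose t) * (- 1) ^ Suc t"
  have "Stirling_sum M I (m(i := m i - t)) = (\<Sum>k\<in>(\<Pi>\<^sub>E j\<in>I - {i}. {..M}). ?P k *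
        (\<Sum>x\<le>M. fact (sum k (I - {i}) + x) * signed_Stirling (m i - t) x))" for t
    using Stirling_sum_remove [OF assms(1,2), of M "m(i := m i - t)"] by simp
  then have "(\<Sum>t=1..m i. ?c t * Stirling_sum M I (m(i := m i - t)))
      = (\<Sum>t=1..m i. \<Sum>k\<in>(\<Pi>\<^sub>E j\<in>I - {i}. {..M}). \<Sum>x\<le>M.
          ?P k * fact (sum k (I - {i}) + x) * (?c t * signed_Stirling (m i - t) x))"
    by (simp add: sum_distrib_left ac_simps)
  also have "\<dots> = (\<Sum>k\<in>(\<Pi>\<^sub>E j\<in>I - {i}. {..M}). \<Sum>x\<le>M. \<Sum>t=1..m i.
          ?P k * fact (sum k (I - {i}) + x) * (?c t * signed_Stirling (m i - t) x))"
    by (subst sum.swap, rule sum.cong, rule refl, rule sum.swap)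
  also have "\<dots> = (\<Sum>k\<in>(\<Pi>\<^sub>E j\<in>I - {i}. {..M}). \<Sum>x\<le>M.
          ?P k * fact (sum k (I - {i}) + x) * (int (Suc x) * signed_Stirling (m i) (Suc x)))"
    unfolding sum_distrib_left [symmetric] sum_binomial_signed_Stirling ..
  also have "\<dots> = (\<Sum>k\<in>(\<Pi>\<^sub>E j\<in>I - {i}. {..M}). \<Sum>x\<le>M.
          ?P k * fact (sum k (I - {i}) + x - 1) * (int x * signed_Stirling (m i) x))"
  proof (rule sum.cong [OF refl])
    fix k
    \<comment> \<open>The factor \<open>x\<close> removes the boundary term at 0, which is also
      where \<open>sum k (I - {i}) + x - 1\<close> could truncate.\<close>
    show "(\<Sum>x\<le>M. ?P k * fact (sum k (I - {i}) + x) * (int (Suc x) * signed_Stirling (m i) (Suc x)))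
      = (\<Sum>x\<le>M. ?P k * fact (sum k (I - {i}) + x - 1) * (int x * signed_Stirling (m i) x))"
      using sum_shift_signed_Stirling [OF assms(3),
          of "\<lambda>x. ?P k * fact (sum k (I - {i}) + x - 1) * int x"]
      by (simp add: mult.assoc)
  qed
  also have "\<dots> = (\<Sum>k\<in>(\<Pi>\<^sub>E i\<in>I. {..M}).
        fact (sum k I - 1) * int (k i) * (\<Prod>i\<in>I. signed_Stirling (m i) (k i)))"
  proof -
    have "fact (sum (k(i := x)) I - 1) * int ((k(i := x)) i) *
          (\<Prod>j\<in>I. signed_Stirling (m j) ((k(i := x)) j))
      = ?P k * fact (sum k (I - {i}) + x - 1) * (int x * signed_Stirling (m i) x)" for k x
    proof -
      have "sum (k(i := x)) (I - {i}) = sum k (I - {i})"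
        by (rule sum.cong) auto
      moreover have "(\<Prod>j\<in>I - {i}. signed_Stirling (m j) ((k(i := x)) j)) = ?P k"
        by (rule prod.cong) auto
      ultimately show ?thesis
        using assms by (simp only: sum.remove prod.remove) (simp add: ac_simps)
    qed
    then show ?thesis
      unfolding sum_PiE_remove [OF assms(2)] by (simp only:)
  qed
  finally show ?thesis .
qed

text \<open>Adding the previous identity over all \<open>i\<close> turns \<open>k i\<close> into the
  total of \<open>k\<close>, which restores the factorial. This is the recursion that
  inclusion-exclusion over sources gives for the orientations.\<close>

lemma Stirling_sum_recursion:
  assumes "finite I" "\<And>i. i \<in> I \<Longrightarrow> m i \<le> M" "i0 \<in> I" "m i0 > 0"
  shows "(\<Sum>i\<in>I. \<Sum>t=1..m i. int (m i choose t) * (- 1) ^ Suc t * Stirling_sum M I (m(i := m i - t)))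
    = Stirling_sum M I m"
proof -
  have "(\<Sum>i\<in>I. \<Sum>t=1..m i. int (m i choose t) * (- 1) ^ Suc t * Stirling_sum M I (m(i := m i - t)))
    = (\<Sum>i\<in>I. \<Sum>k\<in>(\<Pi>\<^sub>E i\<in>I. {..M}).
        fact (sum k I - 1) * int (k i) * (\<Prod>i\<in>I. signed_Stirling (m i) (k i)))"
    using Stirling_sum_remove_part [OF assms(1)] assms(2) by (intro sum.cong) auto
  also have "\<dots> = (\<Sum>k\<in>(\<Pi>\<^sub>E i\<in>I. {..M}).
        fact (sum k I - 1) * int (sum k I) * (\<Prod>i\<in>I. signed_Stirling (m i) (k i)))"
    by (subst sum.swap) (simp add: sum_distrib_left sum_distrib_right)
  also have "\<dots> = Stirling_sum M I m"
    unfolding Stirling_sum_def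
  proof (rule sum.cong [OF refl])
    fix k
    show "fact (sum k I - 1) * int (sum k I) * (\<Prod>i\<in>I. signed_Stirling (m i) (k i))
      = fact (sum k I) * (\<Prod>i\<in>I. signed_Stirling (m i) (k i))"
    \<comment> \<open>For total 0 the left factor is 0 but the factorial is 1; the nonempty part
      \<open>i0\<close> makes the product vanish there.\<close>
    proof (cases "sum k I = 0")
      case True
      then have "k i0 = 0"
        using assms by simp
      then have "signed_Stirling (m i0) (k i0) = 0"
        using assms(4) by (cases "m i0") auto
      then have "(\<Prod>i\<in>I. signed_Stirling (m i) (k i)) = 0"
        using assms by auto
      then show ?thesis by simp
    next
      case False
      then show ?thesis
        by (simp add: fact_reduce [of "sum k I"] mult.commute)
    qed
  qed
  finally show ?thesis .
qed


section \<open>Acyclic orientations and their sources\<close>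

text \<open>Deleting vertices shrinks \<open>W\<close> while \<open>E\<close> stays fixed.\<close>

definition induced_edges :: "'a set set \<Rightarrow> 'a set \<Rightarrow> 'a set set" where
  "induced_edges E W = {e \<in> E. e \<subseteq> W}"

text \<open>The vertex set is an argument because \<open>D\<close> does not show isolated vertices,
  which count as sources.\<close>

definition sources :: "'a set \<Rightarrow> ('a \<times> 'a) set \<Rightarrow> 'a set" where
  "sources W D = {v \<in> W. \<forall>u. (u, v) \<notin> D}"

lemma orientation_induced_edges_iff:
  "orientation (induced_edges E W) D \<longleftrightarrow>
    (\<forall>u v. (u, v) \<in> D \<longrightarrow> u \<in> W \<and> v \<in> W \<and> {u, v} \<in> E) \<and>
    (\<forall>u\<in>W. \<forall>v\<in>W. {u, v} \<in> E \<longrightarrow> ((u, v) \<in> D \<longleftrightarrow> (v, u) \<notin> D))"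
  unfolding orientation_def induced_edges_def mem_Collect_eq insert_subset by blast

lemma orientation_subset: "orientation (induced_edges E W) D \<Longrightarrow> D \<subseteq> W \<times> W"
  by (auto simp only: orientation_induced_edges_iff)

lemma finite_acyclic_orientations:
  "finite W \<Longrightarrow> finite (acyclic_orientations (induced_edges E W))"
  by (rule finite_subset [of _ "Pow (W \<times> W)"])
    (auto simp: acyclic_orientations_def dest: orientation_subset)

lemma acyclic_orientations_empty: "acyclic_orientations {} = {{}}"
  by (auto simp: acyclic_orientations_def orientation_def acyclic_def)

text \<open>A finite acyclic relation is well-founded, and a minimal element of \<open>W\<close> is
  a source because \<open>D\<close> stays inside \<open>W\<close>.\<close>

lemma sources_nonempty:
  assumes "finite W" "W \<noteq> {}" "D \<in> acyclic_orientations (induced_edges E W)"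
  shows "sources W D \<noteq> {}"
proof -
  have D: "D \<subseteq> W \<times> W" "acyclic D"
    using assms(3) by (auto simp: acyclic_orientations_def dest: orientation_subset)
  then have "wf D"
    using assms(1) finite_acyclic_wf finite_subset by blast
  then obtain z where "z \<in> W" "\<And>y. (y, z) \<in> D \<Longrightarrow> y \<notin> W"
    using assms(2) wfE_min' by metis
  then have "z \<in> sources W D"
    using D(1) by (auto simp: sources_def)
  then show ?thesis by blast
qed

text \<open>However an edge between two sources is directed, it would enter one of them.\<close>

lemma sources_independent:
  assumes "\<And>e. e \<in> E \<Longrightarrow> card e = 2"
    and "D \<in> acyclic_orientations (induced_edges E W)" "S \<subseteq> sources W D" "e \<in> E"
  shows "\<not> e \<subseteq> S"
proof
  assume "e \<subseteq> S"
  obtain u v where e: "e = {u, v}"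
    using assms(1) [OF assms(4)] by (auto simp: card_2_iff)
  then have "{u, v} \<in> induced_edges E W" "u \<in> sources W D" "v \<in> sources W D"
    using \<open>e \<subseteq> S\<close> assms(3,4) by (auto simp: induced_edges_def sources_def)
  moreover have "orientation (induced_edges E W) D"
    using assms(2) by (simp add: acyclic_orientations_def)
  ultimately show False
    unfolding orientation_def sources_def by blast
qed

text \<open>No edge enters \<open>S\<close>, so a cycle avoids \<open>S\<close>; a path that starts
  outside \<open>S\<close> uses only edges of \<open>D\<close>.\<close>

lemma acyclic_Un_from:
  assumes "acyclic D" "D \<subseteq> (- S) \<times> (- S)" "T \<subseteq> S \<times> (- S)"
  shows "acyclic (D \<union> T)"
proof -
  have head: "y \<notin> S" if "(x, y) \<in> (D \<union> T)\<^sup>+" for x y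
    using that assms by (induction rule: trancl_induct) auto
  have path: "(x, y) \<in> D\<^sup>+" if "(x, y) \<in> (D \<union> T)\<^sup>+" "x \<notin> S" for x y
    using that(1)
  proof (induction rule: trancl_induct)
    case (base y)
    then show ?case using that assms by auto
  next
    case (step y z)
    then have "(y, z) \<in> D"
      using head assms(3) by blast
    then show ?case
      using step.IH by (rule trancl_into_trancl [rotated])
  qed
  show ?thesis
    using assms(1) head path unfolding acyclic_def by blast
qed

text \<open>Once all vertices of the independent set \<open>S\<close> are sources, every edge at
  \<open>S\<close> has a forced direction. Restriction to \<open>W - S\<close> is therefore a
  bijection, with inverse adding the forced edges.\<close>

lemma card_acyclic_orientations_sources:
  assumes "S \<subseteq> W" "\<And>e. e \<in> E \<Longrightarrow> \<not> e \<subseteq> S"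
  shows "card {D \<in> acyclic_orientations (induced_edges E W). S \<subseteq> sources W D}
    = card (acyclic_orientations (induced_edges E (W - S)))"
proof -
  \<comment> \<open>These are the forced edges, all leaving \<open>S\<close>.\<close>
  define T where "T = {(u, v). u \<in> S \<and> v \<in> W - S \<and> {u, v} \<in> E}"
  have "bij_betw (\<lambda>D. D \<inter> (W - S) \<times> (W - S))
      {D \<in> acyclic_orientations (induced_edges E W). S \<subseteq> sources W D}
      (acyclic_orientations (induced_edges E (W - S)))"
  proof (rule bij_betwI [where g = "\<lambda>D. D \<union> T"])
    show "(\<lambda>D. D \<inter> (W - S) \<times> (W - S))
        \<in> {D \<in> acyclic_orientations (induced_edges E W). S \<subseteq> sources W D}
        \<rightarrow> acyclic_orientations (induced_edges E (W - S))"
    proof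
      fix D assume "D \<in> {D \<in> acyclic_orientations (induced_edges E W). S \<subseteq> sources W D}"
      then have "orientation (induced_edges E W) D" "acyclic D"
        by (auto simp: acyclic_orientations_def)
      then have "orientation (induced_edges E (W - S)) (D \<inter> (W - S) \<times> (W - S))"
        unfolding orientation_induced_edges_iff by blast
      moreover have "acyclic (D \<inter> (W - S) \<times> (W - S))"
        using \<open>acyclic D\<close> by (rule acyclic_subset) auto
      ultimately show "D \<inter> (W - S) \<times> (W - S) \<in> acyclic_orientations (induced_edges E (W - S))"
        by (simp add: acyclic_orientations_def)
    qed
    show "(\<lambda>D. D \<union> T) \<in> acyclic_orientations (induced_edges E (W - S))
        \<rightarrow> {D \<in> acyclic_orientations (induced_edges E W). S \<subseteq> sources W D}"
    proof
      fix D assume "D \<in> acyclic_orientations (induced_edges E (W - S))"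
      then have D: "orientation (induced_edges E (W - S)) D" "acyclic D"
        by (auto simp: acyclic_orientations_def)
      note sub = orientation_subset [OF D(1)]
      have "acyclic (D \<union> T)"
        using D(2) by (rule acyclic_Un_from [where S = S]) (use sub in \<open>auto simp: T_def\<close>)
      moreover have "orientation (induced_edges E W) (D \<union> T)"
        unfolding orientation_induced_edges_iff
      proof (intro conjI allI ballI impI)
        fix u v assume "(u, v) \<in> D \<union> T"
        then show "u \<in> W" "v \<in> W" "{u, v} \<in> E"
          using D(1) assms(1) unfolding orientation_induced_edges_iff T_def by blast+
      next
        fix u v assume uv: "u \<in> W" "v \<in> W" "{u, v} \<in> E"
        then have vu: "{v, u} \<in> E"
          by (simp add: insert_commute)
        have "\<not> (u \<in> S \<and> v \<in> S)"
          using assms(2) [OF uv(3)] by blast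
        then consider "u \<in> S" "v \<notin> S" | "u \<notin> S" "v \<in> S" | "u \<notin> S" "v \<notin> S"
          by blast
        then show "(u, v) \<in> D \<union> T \<longleftrightarrow> (v, u) \<notin> D \<union> T"
        proof cases
          case 3
          then have "(u, v) \<in> D \<longleftrightarrow> (v, u) \<notin> D"
            using D(1) uv unfolding orientation_induced_edges_iff by blast
          then show ?thesis
            using 3 by (simp add: T_def)
        qed (use sub uv vu in \<open>auto simp: T_def\<close>)
      qed
      moreover have "S \<subseteq> sources W (D \<union> T)"
        using sub assms(1) by (auto simp: sources_def T_def)
      ultimately show "D \<union> T \<in> {D \<in> acyclic_orientations (induced_edges E W). S \<subseteq> sources W D}"
        by (simp add: acyclic_orientations_def)
    qed
  next
    fix D assume "D \<in> {D \<in> acyclic_orientations (induced_edges E W). S \<subseteq> sources W D}"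
    then have D: "orientation (induced_edges E W) D" "S \<subseteq> sources W D"
      by (auto simp: acyclic_orientations_def)
    have "u \<in> W \<and> v \<in> W \<and> v \<notin> S \<and> {u, v} \<in> E" if "(u, v) \<in> D" for u v
      using D that unfolding orientation_induced_edges_iff sources_def by blast
    \<comment> \<open>The opposite direction would enter \<open>S\<close>, contradicting that its
      vertices are sources.\<close>
    moreover have "(u, v) \<in> D" if "(u, v) \<in> T" for u v
      using that D assms(1) unfolding orientation_induced_edges_iff sources_def T_def by blast
    ultimately show "D \<inter> (W - S) \<times> (W - S) \<union> T = D"
      unfolding T_def by (intro equalityI subrelI) blast+
  next
    fix D assume "D \<in> acyclic_orientations (induced_edges E (W - S))"
    then have "D \<subseteq> (W - S) \<times> (W - S)"
      by (auto simp: acyclic_orientations_def dest: orientation_subset)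
    then show "(D \<union> T) \<inter> (W - S) \<times> (W - S) = D"
      by (auto simp: T_def)
  qed
  then show ?thesis
    by (rule bij_betw_same_card)
qed

lemma sum_Pow_card:
  fixes F :: "nat \<Rightarrow> 'b :: comm_semiring_1"
  assumes "finite A"
  shows "(\<Sum>S\<in>Pow A - {{}}. F (card S)) = (\<Sum>t=1..card A. of_nat (card A choose t) * F t)"
proof -
  have fin: "finite (Pow A - {{}})"
    using assms by simp
  have img: "card ` (Pow A - {{}}) \<subseteq> {1..card A}"
    using assms by (auto simp: Suc_le_eq card_gt_0_iff card_mono dest: finite_subset)
  have "(\<Sum>S\<in>Pow A - {{}}. F (card S)) = (\<Sum>t=1..card A. \<Sum>S\<in>{S \<in> Pow A - {{}}. card S = t}. F (card S))"
    by (rule sum.group [symmetric, OF fin _ img]) simp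
  also have "\<dots> = (\<Sum>t=1..card A. of_nat (card A choose t) * F t)"
  proof (rule sum.cong [OF refl])
    fix t assume "t \<in> {1..card A}"
    then have "{S \<in> Pow A - {{}}. card S = t} = {S. S \<subseteq> A \<and> card S = t}"
      by auto
    then show "(\<Sum>S\<in>{S \<in> Pow A - {{}}. card S = t}. F (card S)) = of_nat (card A choose t) * F t"
      by (simp add: n_subsets assms)
  qed
  finally show ?thesis .
qed

text \<open>The alternating sum of all binomial coefficients vanishes for nonempty \<open>A\<close>;
  the empty set's term is moved to the other side.\<close>

lemma sum_Pow_alternating:
  assumes "finite A" "A \<noteq> {}"
  shows "(\<Sum>S\<in>Pow A - {{}}. (- 1) ^ Suc (card S)) = (1 :: int)"
proof -
  have "card A > 0"
    using assms by (simp add: card_gt_0_iff)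
  then have "(\<Sum>t\<le>card A. (- 1) ^ t * int (card A choose t)) = 0"
    using choose_alternating_sum [of "card A", where 'a = int] by simp
  moreover have "{..card A} = insert 0 {1..card A}"
    by auto
  ultimately have "(\<Sum>t=1..card A. int (card A choose t) * (- 1) ^ Suc t) = 1"
    by (simp add: sum_negf mult.commute)
  then show ?thesis
    using sum_Pow_card [OF assms(1), of "\<lambda>t. (- 1 :: int) ^ Suc t"] by simp
qed

text \<open>
  Inclusion-exclusion: an acyclic orientation is counted on the right once for every nonempty
  set of its sources, with alternating signs that add up to 1.
\<close>

lemma acyclic_orientations_recursion:
  assumes "\<And>e. e \<in> E \<Longrightarrow> card e = 2" "finite W" "W \<noteq> {}"
  shows "int (card (acyclic_orientations (induced_edges E W)))
    = (\<Sum>S\<in>{S. S \<subseteq> W \<and> S \<noteq> {} \<and> (\<forall>e\<in>E. \<not> e \<subseteq> S)}.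
        (- 1) ^ Suc (card S) * int (card (acyclic_orientations (induced_edges E (W - S)))))"
proof -
  let ?A = "acyclic_orientations (induced_edges E W)"
  let ?I = "{S. S \<subseteq> W \<and> S \<noteq> {} \<and> (\<forall>e\<in>E. \<not> e \<subseteq> S)}"
  have fin: "finite ?A" "finite ?I"
    using assms(2) by (auto simp: finite_acyclic_orientations)
  have "int (card ?A) = (\<Sum>D\<in>?A. \<Sum>S\<in>Pow (sources W D) - {{}}. (- 1) ^ Suc (card S))"
  proof -
    have "(\<Sum>S\<in>Pow (sources W D) - {{}}. (- 1) ^ Suc (card S)) = (1 :: int)" if "D \<in> ?A" for D
      by (rule sum_Pow_alternating) (use assms(2) sources_nonempty [OF assms(2,3) that] in \<open>auto simp: sources_def\<close>)
    then show ?thesis by simp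
  qed
  also have "\<dots> = (\<Sum>D\<in>?A. \<Sum>S\<in>{S \<in> ?I. S \<subseteq> sources W D}. (- 1) ^ Suc (card S))"
  proof (rule sum.cong [OF refl])
    fix D assume "D \<in> ?A"
    \<comment> \<open>Sets of sources are automatically independent, so the range can be taken from
      a family that does not depend on \<open>D\<close>, ready for exchanging the sums.\<close>
    then have "Pow (sources W D) - {{}} = {S \<in> ?I. S \<subseteq> sources W D}"
      using sources_independent [OF assms(1)] by (auto simp: sources_def)
    then show "(\<Sum>S\<in>Pow (sources W D) - {{}}. (- 1) ^ Suc (card S))
        = (\<Sum>S\<in>{S \<in> ?I. S \<subseteq> sources W D}. (- 1) ^ Suc (card S) :: int)"
      by simp
  qed
  also have "\<dots> = (\<Sum>S\<in>?I. \<Sum>D\<in>{D \<in> ?A. S \<subseteq> sources W D}. (- 1) ^ Suc (card S))"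
    by (rule sum.swap_restrict [OF fin])
  also have "\<dots> = (\<Sum>S\<in>?I. (- 1) ^ Suc (card S) *
      int (card (acyclic_orientations (induced_edges E (W - S)))))"
    by (rule sum.cong [OF refl]) (simp add: card_acyclic_orientations_sources mult.commute)
  finally show ?thesis .
qed


section \<open>Complete multipartite graphs\<close>

text \<open>Both sides satisfy the same recursion, so induction on \<open>W\<close> applies. The map
  \<open>p\<close> assigns parts; \<open>V\<close>, \<open>I\<close> and \<open>M\<close> stay fixed
  as \<open>W\<close> shrinks.\<close>

lemma card_acyclic_orientations_parts:
  fixes p :: "'a \<Rightarrow> 'i"
  assumes "finite W" "finite I" "p ` W \<subseteq> I" "card W \<le> M" "W \<subseteq> V"
  shows "int (card (acyclic_orientations
      (induced_edges {{u, v} | u v. u \<in> V \<and> v \<in> V \<and> p u \<noteq> p v} W)))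
    = Stirling_sum M I (\<lambda>i. card {v \<in> W. p v = i})"
  using assms
proof (induction W rule: finite_psubset_induct)
  case (psubset W)
  define E where "E = {{u, v} | u v. u \<in> V \<and> v \<in> V \<and> p u \<noteq> p v}"
  define P where "P i = {v \<in> W. p v = i}" for i
  have card_E: "card e = 2" if "e \<in> E" for e
    using that by (auto simp: E_def card_insert_if)
  have fin: "finite (P i)" for i
    using psubset.hyps by (simp add: P_def)
  show ?case
  proof (cases "W = {}")
    case True
    then have "induced_edges E W = {}"
      by (auto simp: E_def induced_edges_def)
    then show ?thesis
      using True psubset.prems by (simp add: E_def acyclic_orientations_empty Stirling_sum_zero)
  next
    case False
    then obtain w where w: "w \<in> W" by blast
    have IH: "int (card (acyclic_orientations (induced_edges E (W - S))))
        = Stirling_sum M I ((\<lambda>i. card (P i))(i := card (P i) - card S))"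
      if S: "S \<in> Pow (P i) - {{}}" for i S
    proof -
      have "W - S \<subset> W" "p ` (W - S) \<subseteq> I" "W - S \<subseteq> V"
        using S psubset.prems by (auto simp: P_def)
      moreover have "card (W - S) \<le> M"
        using card_mono [of W "W - S"] psubset.hyps psubset.prems by simp
      ultimately have "int (card (acyclic_orientations (induced_edges E (W - S))))
          = Stirling_sum M I (\<lambda>j. card {v \<in> W - S. p v = j})"
        unfolding E_def using psubset.IH psubset.prems(1) by blast
      also have "(\<lambda>j. card {v \<in> W - S. p v = j}) = (\<lambda>i. card (P i))(i := card (P i) - card S)"
      proof
        fix j
        show "card {v \<in> W - S. p v = j} = ((\<lambda>i. card (P i))(i := card (P i) - card S)) j"
        proof (cases "j = i")
          case True
          then have "{v \<in> W - S. p v = j} = P i - S"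
            by (auto simp: P_def)
          moreover have "card (P i - S) = card (P i) - card S"
            using S fin by (auto intro: card_Diff_subset dest: finite_subset)
          ultimately show ?thesis
            using True by simp
        next
          case False
          then have "{v \<in> W - S. p v = j} = P j"
            using S by (auto simp: P_def)
          then show ?thesis
            using False by simp
        qed
      qed
      finally show ?thesis .
    qed
    have indep: "{S. S \<subseteq> W \<and> S \<noteq> {} \<and> (\<forall>e\<in>E. \<not> e \<subseteq> S)} = (\<Union>i\<in>I. Pow (P i) - {{}})"
    proof (intro equalityI subsetI)
      fix S assume S: "S \<in> {S. S \<subseteq> W \<and> S \<noteq> {} \<and> (\<forall>e\<in>E. \<not> e \<subseteq> S)}"
      then obtain u where u: "u \<in> S" by blast
      have "p v = p u" if "v \<in> S" for v
      proof (rule ccontr)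
        assume "p v \<noteq> p u"
        moreover have "v \<in> V" "u \<in> V"
          using S u that psubset.prems by auto
        ultimately have "{v, u} \<in> E"
          unfolding E_def by blast
        moreover have "{v, u} \<subseteq> S"
          using u that by simp
        ultimately show False
          using S by fast
      qed
      then have "S \<subseteq> P (p u)" "p u \<in> I"
        using S u psubset.prems(2) unfolding P_def by blast+
      then show "S \<in> (\<Union>i\<in>I. Pow (P i) - {{}})"
        using u by blast
    next
      fix S assume "S \<in> (\<Union>i\<in>I. Pow (P i) - {{}})"
      then obtain i where i: "S \<subseteq> P i" "S \<noteq> {}"
        by blast
      have "\<not> e \<subseteq> S" if "e \<in> E" for e
      proof
        assume "e \<subseteq> S"
        obtain u v where "e = {u, v}" "p u \<noteq> p v"
          using \<open>e \<in> E\<close> unfolding E_def by blast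
        then have "u \<in> P i" "v \<in> P i"
          using \<open>e \<subseteq> S\<close> i(1) by auto
        then show False
          using \<open>p u \<noteq> p v\<close> by (simp add: P_def)
      qed
      then show "S \<in> {S. S \<subseteq> W \<and> S \<noteq> {} \<and> (\<forall>e\<in>E. \<not> e \<subseteq> S)}"
        using i by (auto simp: P_def)
    qed
    have "int (card (acyclic_orientations (induced_edges E W)))
      = (\<Sum>S\<in>(\<Union>i\<in>I. Pow (P i) - {{}}). (- 1) ^ Suc (card S) *
          int (card (acyclic_orientations (induced_edges E (W - S)))))"
      unfolding indep [symmetric]
      using card_E psubset.hyps(1) False by (rule acyclic_orientations_recursion)
    also have "\<dots> = (\<Sum>i\<in>I. \<Sum>S\<in>Pow (P i) - {{}}. (- 1) ^ Suc (card S) *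
          int (card (acyclic_orientations (induced_edges E (W - S)))))"
    \<comment> \<open>The families of different parts are disjoint because the empty set has been
      removed.\<close>
    proof (rule sum.UNION_disjoint)
      show "\<forall>i\<in>I. \<forall>j\<in>I. i \<noteq> j \<longrightarrow> (Pow (P i) - {{}}) \<inter> (Pow (P j) - {{}}) = {}"
        by (fastforce simp: P_def)
    qed (use psubset.prems fin in auto)
    also have "\<dots> = (\<Sum>i\<in>I. \<Sum>S\<in>Pow (P i) - {{}}. (- 1) ^ Suc (card S) *
          Stirling_sum M I ((\<lambda>i. card (P i))(i := card (P i) - card S)))"
      by (intro sum.cong refl) (simp add: IH)
    \<comment> \<open>The summand depends on \<open>S\<close> only through its size, so subsets of a
      part are grouped by cardinality.\<close>
    also have "\<dots> = (\<Sum>i\<in>I. \<Sum>t=1..card (P i). int (card (P i) choose t) * (- 1) ^ Suc t *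
          Stirling_sum M I ((\<lambda>i. card (P i))(i := card (P i) - t)))"
      by (rule sum.cong [OF refl], subst sum_Pow_card [OF fin]) (simp add: mult.assoc)
    also have "\<dots> = Stirling_sum M I (\<lambda>i. card (P i))"
    proof (rule Stirling_sum_recursion)
      show "card (P i) \<le> M" for i
        using card_mono [of W "P i"] psubset.hyps psubset.prems by (auto simp: P_def)
      show "p w \<in> I" "card (P (p w)) > 0"
        using w fin psubset.prems by (auto simp: card_gt_0_iff P_def)
    qed (use psubset.prems in auto)
    finally show ?thesis
      by (simp add: E_def P_def)
  qed
qed

lemma card_acyclic_orientations_multipartite:
  fixes n :: "nat \<Rightarrow> nat"
  shows "int (card (acyclic_orientations (multipartite_edges N n)))
    = Stirling_sum (\<Sum>i=1..N. n i) {1..N} n"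
proof -
  let ?V = "multipartite_verts N n"
  have V: "finite ?V" "fst ` ?V \<subseteq> {1..N}" "card ?V \<le> (\<Sum>i=1..N. n i)"
    by (auto simp: multipartite_verts_def)
  have "induced_edges {{u, v} | u v. u \<in> ?V \<and> v \<in> ?V \<and> fst u \<noteq> fst v} ?V = multipartite_edges N n"
    by (auto simp: induced_edges_def multipartite_edges_def)
  then have "int (card (acyclic_orientations (multipartite_edges N n)))
      = Stirling_sum (\<Sum>i=1..N. n i) {1..N} (\<lambda>i. card {v \<in> ?V. fst v = i})"
    using card_acyclic_orientations_parts [OF V(1) _ V(2,3) order_refl] by simp
  also have "\<dots> = Stirling_sum (\<Sum>i=1..N. n i) {1..N} n"
  proof (rule Stirling_sum_cong)
    fix i assume "i \<in> {1..N}"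
    then have "{v \<in> ?V. fst v = i} = {i} \<times> {1..n i}"
      by (auto simp: multipartite_verts_def)
    then show "card {v \<in> ?V. fst v = i} = n i"
      by (simp add: card_cartesian_product)
  qed
  finally show ?thesis .
qed

theorem theorem6p5:
  fixes N :: nat and n :: "nat \<Rightarrow> nat"
  assumes "N \<ge> 2"
    and "\<And>i. i \<in> {2..N} \<Longrightarrow> n i \<ge> 1"
  shows "int (card (acyclic_orientations (multipartite_edges N n))) =
    (\<Sum>k\<in>(\<Pi>\<^sub>E i\<in>{2..N}. {1..n i}).
       (- 1) ^ ((\<Sum>i=2..N. n i) - (\<Sum>i=2..N. k i))
       * (1 + int (\<Sum>i=2..N. k i)) ^ n 1
       * fact (\<Sum>i=2..N. k i)
       * (\<Prod>i=2..N. int (Stirling (n i) (k i))))"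
proof -
  define M where "M = (\<Sum>i=1..N. n i)"
  have n_le: "n i \<le> M" if "i \<in> {1..N}" for i
    unfolding M_def using that by (intro member_le_sum) auto
  have I: "{1..N} - {1} = {2..N}"
    by auto
  have "int (card (acyclic_orientations (multipartite_edges N n))) =
    (\<Sum>k\<in>(\<Pi>\<^sub>E i\<in>{2..N}. {..M}). (\<Prod>i=2..N. signed_Stirling (n i) (k i)) *
      (\<Sum>x\<le>M. fact (sum k {2..N} + x) * signed_Stirling (n 1) x))"
    unfolding card_acyclic_orientations_multipartite M_def [symmetric]
    using Stirling_sum_remove [of "{1..N}" 1 M n] assms(1) unfolding I by simp
  also have "\<dots> = (\<Sum>k\<in>(\<Pi>\<^sub>E i\<in>{2..N}. {..M}). (\<Prod>i=2..N. signed_Stirling (n i) (k i)) *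
      (fact (sum k {2..N}) * (1 + int (sum k {2..N})) ^ n 1))"
    \<comment> \<open>The sum over the first index is evaluated; this holds for
      \<open>n 1 = 0\<close> as well.\<close>
    using assms(1) n_le [of 1] by (simp add: sum_fact_signed_Stirling)
  also have "\<dots> = (\<Sum>k\<in>(\<Pi>\<^sub>E i\<in>{2..N}. {1..n i}). (\<Prod>i=2..N. signed_Stirling (n i) (k i)) *
      (fact (sum k {2..N}) * (1 + int (sum k {2..N})) ^ n 1))"
  \<comment> \<open>Outside the smaller range some \<open>k i\<close> exceeds \<open>n i\<close>, or
    is 0 while \<open>n i\<close> is positive; either way a Stirling factor vanishes.\<close>
  proof (rule sum.mono_neutral_right)
    show "finite (\<Pi>\<^sub>E i\<in>{2..N}. {..M})"
      by (simp add: finite_PiE)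
    show "(\<Pi>\<^sub>E i\<in>{2..N}. {1..n i}) \<subseteq> (\<Pi>\<^sub>E i\<in>{2..N}. {..M})"
    proof (rule PiE_mono)
      fix i assume "i \<in> {2..N}"
      then have "n i \<le> M"
        by (intro n_le) auto
      then show "{1..n i} \<subseteq> {..M}"
        by auto
    qed
    show "\<forall>k\<in>(\<Pi>\<^sub>E i\<in>{2..N}. {..M}) - (\<Pi>\<^sub>E i\<in>{2..N}. {1..n i}).
        (\<Prod>i=2..N. signed_Stirling (n i) (k i)) *
        (fact (sum k {2..N}) * (1 + int (sum k {2..N})) ^ n 1) = 0"
    proof
      fix k assume "k \<in> (\<Pi>\<^sub>E i\<in>{2..N}. {..M}) - (\<Pi>\<^sub>E i\<in>{2..N}. {1..n i})"
      then obtain i where i: "i \<in> {2..N}" "k i \<notin> {1..n i}"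
        by (auto simp: PiE_iff)
      then consider "k i = 0" | "n i < k i"
        by fastforce
      then have "signed_Stirling (n i) (k i) = 0"
      proof cases
        case 1
        then show ?thesis
          using assms(2) [OF i(1)] by (cases "n i") auto
      qed (simp add: signed_Stirling_eq_0)
      then have "(\<Prod>i=2..N. signed_Stirling (n i) (k i)) = 0"
        using i(1) by auto
      then show "(\<Prod>i=2..N. signed_Stirling (n i) (k i)) *
        (fact (sum k {2..N}) * (1 + int (sum k {2..N})) ^ n 1) = 0"
        by simp
    qed
  qed
  also have "\<dots> = (\<Sum>k\<in>(\<Pi>\<^sub>E i\<in>{2..N}. {1..n i}).
       (- 1) ^ ((\<Sum>i=2..N. n i) - (\<Sum>i=2..N. k i))
       * (1 + int (\<Sum>i=2..N. k i)) ^ n 1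
       * fact (\<Sum>i=2..N. k i)
       * (\<Prod>i=2..N. int (Stirling (n i) (k i))))"
  proof (rule sum.cong [OF refl])
    fix k assume "k \<in> (\<Pi>\<^sub>E i\<in>{2..N}. {1..n i})"
    then have le: "sum k {2..N} \<le> sum n {2..N}"
      by (intro sum_mono) (auto simp: PiE_iff)
    have "(\<Prod>i=2..N. signed_Stirling (n i) (k i))
        = (- 1) ^ (sum n {2..N} + sum k {2..N}) * (\<Prod>i=2..N. int (Stirling (n i) (k i)))"
      by (simp add: signed_Stirling_def prod.distrib sum.distrib flip: power_sum)
    \<comment> \<open>The bound \<open>le\<close> rules out truncation, so sum and difference have
      the same parity.\<close>
    also have "(- 1 :: int) ^ (sum n {2..N} + sum k {2..N}) = (- 1) ^ (sum n {2..N} - sum k {2..N})"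
      using le by (simp add: minus_one_power_iff)
    finally show "(\<Prod>i=2..N. signed_Stirling (n i) (k i)) *
        (fact (sum k {2..N}) * (1 + int (sum k {2..N})) ^ n 1)
      = (- 1) ^ (sum n {2..N} - sum k {2..N}) * (1 + int (sum k {2..N})) ^ n 1
       * fact (sum k {2..N}) * (\<Prod>i=2..N. int (Stirling (n i) (k i)))"
      by (simp only: ac_simps)
  qed
  finally show ?thesis .
qed

end
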